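(* Let $k$ be a positive integer. Let $\vec v_1\in P_k$ and $\vec v_2\in clP_k$, and consider two sequences of permutations $(\sigma_1^m)_{m\in\mathbb N}$ and $(\sigma_2^m)_{m\in\mathbb N}$ such that $$|\sigma_1^m|\to\infty,\quad (\widetilde{\mathrm{c\text{-}occ}}(\pi,\sigma_1^m))_{\pi\in\mathcal S_k}\to\vec v_1,\qquad |\sigma_2^m|\to\infty,\quad (\widetilde{\mathrm{occ}}(\pi,\sigma_2^m))_{\pi\in\mathcal S_k}\to\vec v_2.$$ Define $\sigma_3^m:=\sigma_2^m[\sigma_1^m,\dots,\sigma_1^m]$ for all $m\in\mathbb N$. Then $$|\sigma_3^m|\to\infty,\quad (\widetilde{\mathrm{c\text{-}occ}}(\pi,\sigma_3^m))_{\pi\in\mathcal S_k}\to\vec v_1,\quad (\widetilde{\mathrm{occ}}(\pi,\sigma_3^m))_{\pi\in\mathcal S_k}\to\vec v_2.$$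
   Context: $\mathcal S_n$ is the set of permutations of size $n$ (one-line notation). For $\sigma\in\mathcal S_n$, $\pi\in\mathcal S_k$: $\mathrm{occ}(\pi,\sigma)$ is the number of index sets $i_1<\dots<i_k$ such that $\sigma(i_1)\dots\sigma(i_k)$ has the same relative order as $\pi$, and $\widetilde{\mathrm{occ}}(\pi,\sigma)=\mathrm{occ}(\pi,\sigma)/\binom nk$; $\mathrm{c\text{-}occ}(\pi,\sigma)$ is the number of such occurrences whose indices form an interval $i,i+1,\dots,i+k-1$, and $\widetilde{\mathrm{c\text{-}occ}}(\pi,\sigma)=\mathrm{c\text{-}occ}(\pi,\sigma)/n$. $P_k$ (resp. $clP_k$) is the set of $\vec v\in[0,1]^{\mathcal S_k}$ such that some sequence $(\sigma^m)$ with $|\sigma^m|\to\infty$ satisfies $\widetilde{\mathrm{c\text{-}occ}}(\pi,\sigma^m)\to\vec v_\pi$ (resp. $\widetilde{\mathrm{occ}}(\pi,\sigma^m)\to\vec v_\pi$) for all $\pi\in\mathcal S_k$. For $\sigma\in\mathcal S_n$ and permutations $\tau_1,\dots,\tau_n$, the inflation $\sigma[\tau_1,\dots,\tau_n]$ is the permutation formed by consecutive disjoint blocks $\tau'_1,\dots,\tau'_n$ (from left to right), each block $\tau_i'$ consisting of a set of consecutive values and having the same relative order as $\tau_i$, with the blocks' value sets ordered relative to each other as given by $\sigma$. *)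

theory Defs
  imports Complex_Main "HOL-Library.FuncSet" "HOL-Combinatorics.Multiset_Permutations"
begin

text \<open>
  A permutation is represented by its one-line notation, a list containing each of
  1, ..., n exactly once; its size is the length of the list. Values start at 1, while
  positions follow list indexing and start at 0.
\<close>

abbreviation perms :: "nat \<Rightarrow> nat list set" where
  "perms n \<equiv> permutations_of_set {1..n}"

definition is_perm :: "nat list \<Rightarrow> bool" where
  "is_perm \<sigma> \<longleftrightarrow> \<sigma> \<in> perms (length \<sigma>)"

definition same_rel_order :: "nat list \<Rightarrow> nat list \<Rightarrow> bool" where
  "same_rel_order xs ys \<longleftrightarrow> length xs = length ys \<and>
     (\<forall>i<length xs. \<forall>j<length xs. xs ! i < xs ! j \<longleftrightarrow> ys ! i < ys ! j)"

text \<open>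
  An index set I stands for the increasing sequence of its elements, and \<open>nths \<sigma> I\<close> is the
  corresponding subsequence; the equality of lengths forces I to have the size of \<open>\<pi>\<close>.
\<close>

definition occurrences :: "nat list \<Rightarrow> nat list \<Rightarrow> nat set set" where
  "occurrences \<pi> \<sigma> = {I. I \<subseteq> {..<length \<sigma>} \<and> same_rel_order (nths \<sigma> I) \<pi>}"

definition occ :: "nat list \<Rightarrow> nat list \<Rightarrow> nat" where
  "occ \<pi> \<sigma> = card (occurrences \<pi> \<sigma>)"

definition c_occ :: "nat list \<Rightarrow> nat list \<Rightarrow> nat" where
  "c_occ \<pi> \<sigma> = card {I \<in> occurrences \<pi> \<sigma>. \<exists>i. I = {i..<i + length \<pi>}}"

text \<open>
  Where a denominator vanishes (\<open>\<sigma>\<close> shorter than \<open>\<pi>\<close>, resp. empty) the proportion is 0. This is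
  irrelevant for limits along permutations of diverging size.
\<close>

definition occ_prop :: "nat list \<Rightarrow> nat list \<Rightarrow> real" where
  "occ_prop \<pi> \<sigma> = real (occ \<pi> \<sigma>) / real (length \<sigma> choose length \<pi>)"

definition c_occ_prop :: "nat list \<Rightarrow> nat list \<Rightarrow> real" where
  "c_occ_prop \<pi> \<sigma> = real (c_occ \<pi> \<sigma>) / real (length \<sigma>)"

definition consecutive_region :: "nat \<Rightarrow> (nat list \<Rightarrow> real) set" where
  "consecutive_region k = {v \<in> perms k \<rightarrow>\<^sub>E {0..1}. \<exists>\<sigma> :: nat \<Rightarrow> nat list.
     (\<forall>m. is_perm (\<sigma> m)) \<and> filterlim (\<lambda>m. length (\<sigma> m)) at_top sequentially \<and>
     (\<forall>\<pi>\<in>perms k. (\<lambda>m. c_occ_prop \<pi> (\<sigma> m)) \<longlonglongrightarrow> v \<pi>)}"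

definition classical_region :: "nat \<Rightarrow> (nat list \<Rightarrow> real) set" where
  "classical_region k = {v \<in> perms k \<rightarrow>\<^sub>E {0..1}. \<exists>\<sigma> :: nat \<Rightarrow> nat list.
     (\<forall>m. is_perm (\<sigma> m)) \<and> filterlim (\<lambda>m. length (\<sigma> m)) at_top sequentially \<and>
     (\<forall>\<pi>\<in>perms k. (\<lambda>m. occ_prop \<pi> (\<sigma> m)) \<longlonglongrightarrow> v \<pi>)}"

text \<open>
  The i-th block of the inflation is the i-th inflating permutation, shifted by the total size
  of the blocks whose values have to lie below it. Meaningful when both lists have the same
  length; \<open>inflation_blocks\<close> and \<open>is_perm_inflation\<close> below show that the result is
  the permutation with the defining properties of the inflation.
\<close>

definition block_offset :: "nat list \<Rightarrow> nat list list \<Rightarrow> nat \<Rightarrow> nat" where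
  "block_offset \<sigma> \<tau>s i = (\<Sum>j | j < length \<sigma> \<and> \<sigma> ! j < \<sigma> ! i. length (\<tau>s ! j))"

definition inflation_block :: "nat list \<Rightarrow> nat list list \<Rightarrow> nat \<Rightarrow> nat list" where
  "inflation_block \<sigma> \<tau>s i = map (\<lambda>x. block_offset \<sigma> \<tau>s i + x) (\<tau>s ! i)"

definition inflation :: "nat list \<Rightarrow> nat list list \<Rightarrow> nat list" where
  "inflation \<sigma> \<tau>s = concat (map (inflation_block \<sigma> \<tau>s) [0..<length \<sigma>])"

lemma is_perm_iff: "is_perm \<sigma> \<longleftrightarrow> distinct \<sigma> \<and> set \<sigma> = {1..length \<sigma>}"
  by (auto simp: is_perm_def permutations_of_set_def)

lemma perms_iff: "\<sigma> \<in> perms n \<longleftrightarrow> is_perm \<sigma> \<and> length \<sigma> = n"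
  by (auto simp: is_perm_def length_finite_permutations_of_set)

lemma block_offset_mono:
  assumes "i < length \<sigma>" "\<sigma> ! i < \<sigma> ! j"
  shows "block_offset \<sigma> \<tau>s i + length (\<tau>s ! i) \<le> block_offset \<sigma> \<tau>s j"
proof -
  have "block_offset \<sigma> \<tau>s i + length (\<tau>s ! i) =
      (\<Sum>l\<in>insert i {l. l < length \<sigma> \<and> \<sigma> ! l < \<sigma> ! i}. length (\<tau>s ! l))"
    by (simp add: block_offset_def)
  also have "\<dots> \<le> block_offset \<sigma> \<tau>s j"
    unfolding block_offset_def using assms by (intro sum_mono2) auto
  finally show ?thesis .
qed

lemma block_offset_le:
  assumes "i < length \<sigma>"
  shows "block_offset \<sigma> \<tau>s i + length (\<tau>s ! i) \<le> (\<Sum>j<length \<sigma>. length (\<tau>s ! j))"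
proof -
  have "block_offset \<sigma> \<tau>s i + length (\<tau>s ! i) =
      (\<Sum>l\<in>insert i {l. l < length \<sigma> \<and> \<sigma> ! l < \<sigma> ! i}. length (\<tau>s ! l))"
    by (simp add: block_offset_def)
  also have "\<dots> \<le> (\<Sum>j<length \<sigma>. length (\<tau>s ! j))"
    using assms by (intro sum_mono2) auto
  finally show ?thesis .
qed

lemma set_inflation_block:
  assumes "is_perm (\<tau>s ! i)"
  shows "set (inflation_block \<sigma> \<tau>s i) =
    {block_offset \<sigma> \<tau>s i + 1..block_offset \<sigma> \<tau>s i + length (\<tau>s ! i)}"
proof -
  have "set (inflation_block \<sigma> \<tau>s i) = (\<lambda>x. block_offset \<sigma> \<tau>s i + x) ` {1..length (\<tau>s ! i)}"
    using assms by (simp add: inflation_block_def is_perm_iff)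
  then show ?thesis by (simp add: add.commute)
qed

lemma inflation_blocks:
  assumes "is_perm \<sigma>" "length \<tau>s = length \<sigma>" "\<forall>\<tau>\<in>set \<tau>s. is_perm \<tau>"
  shows "\<And>i. same_rel_order (inflation_block \<sigma> \<tau>s i) (\<tau>s ! i)"
    and "\<And>i. i < length \<sigma> \<Longrightarrow> \<exists>a b. set (inflation_block \<sigma> \<tau>s i) = {a..b}"
    and "\<And>i j x y. i < length \<sigma> \<Longrightarrow> j < length \<sigma> \<Longrightarrow> \<sigma> ! i < \<sigma> ! j \<Longrightarrow>
      x \<in> set (inflation_block \<sigma> \<tau>s i) \<Longrightarrow> y \<in> set (inflation_block \<sigma> \<tau>s j) \<Longrightarrow> x < y"
proof -
  fix i show "same_rel_order (inflation_block \<sigma> \<tau>s i) (\<tau>s ! i)"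
    by (simp add: same_rel_order_def inflation_block_def)
next
  fix i assume "i < length \<sigma>"
  then show "\<exists>a b. set (inflation_block \<sigma> \<tau>s i) = {a..b}"
    using set_inflation_block assms by (metis nth_mem)
next
  fix i j x y
  assume *: "i < length \<sigma>" "j < length \<sigma>" "\<sigma> ! i < \<sigma> ! j"
    "x \<in> set (inflation_block \<sigma> \<tau>s i)" "y \<in> set (inflation_block \<sigma> \<tau>s j)"
  have "is_perm (\<tau>s ! i)" "is_perm (\<tau>s ! j)" using assms * by auto
  with * block_offset_mono[OF *(1,3), of \<tau>s] show "x < y" by (auto simp: set_inflation_block)
qed

lemma length_inflation: "length (inflation \<sigma> \<tau>s) = (\<Sum>j<length \<sigma>. length (\<tau>s ! j))"
proof -
  have "length (inflation \<sigma> \<tau>s) = (\<Sum>j\<leftarrow>[0..<length \<sigma>]. length (\<tau>s ! j))"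
    by (simp add: inflation_def length_concat inflation_block_def comp_def)
  then show ?thesis by (simp add: interv_sum_list_conv_sum_set_nat atLeast0LessThan)
qed

lemma is_perm_inflation:
  assumes "is_perm \<sigma>" "length \<tau>s = length \<sigma>" "\<forall>\<tau>\<in>set \<tau>s. is_perm \<tau>"
  shows "is_perm (inflation \<sigma> \<tau>s)"
proof -
  have perm: "is_perm (\<tau>s ! i)" if "i < length \<sigma>" for i using assms that by auto
  have disj: "set (inflation_block \<sigma> \<tau>s i) \<inter> set (inflation_block \<sigma> \<tau>s j) = {}"
    if "i < length \<sigma>" "j < length \<sigma>" "i \<noteq> j" for i j
  proof -
    have "\<sigma> ! i < \<sigma> ! j \<or> \<sigma> ! j < \<sigma> ! i"
      using that assms(1) by (auto simp: is_perm_iff nth_eq_iff_index_eq neq_iff[symmetric])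
    then show ?thesis using inflation_blocks(3)[OF assms] that by blast
  qed
  have "distinct (concat (map (inflation_block \<sigma> \<tau>s) [0..<n]))" if "n \<le> length \<sigma>" for n
    using that
  proof (induction n)
    case (Suc n)
    have "distinct (inflation_block \<sigma> \<tau>s n)"
      using perm[of n] Suc.prems by (simp add: inflation_block_def distinct_map is_perm_iff)
    moreover have "set (inflation_block \<sigma> \<tau>s i) \<inter> set (inflation_block \<sigma> \<tau>s n) = {}"
      if "i < n" for i
      using that Suc.prems by (intro disj) auto
    then have "(\<Union>i\<in>{0..<n}. set (inflation_block \<sigma> \<tau>s i)) \<inter> set (inflation_block \<sigma> \<tau>s n) = {}"
      by (force simp: disjoint_iff)
    ultimately show ?case using Suc by simp
  qed simp
  then have dist: "distinct (inflation \<sigma> \<tau>s)" by (simp add: inflation_def)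
  have "set (inflation \<sigma> \<tau>s) \<subseteq> {1..length (inflation \<sigma> \<tau>s)}"
  proof
    fix x assume "x \<in> set (inflation \<sigma> \<tau>s)"
    then obtain i where i: "i < length \<sigma>" "x \<in> set (inflation_block \<sigma> \<tau>s i)"
      by (auto simp: inflation_def)
    with set_inflation_block[OF perm] block_offset_le[OF i(1), of \<tau>s]
    show "x \<in> {1..length (inflation \<sigma> \<tau>s)}" by (auto simp: length_inflation)
  qed
  moreover have "card (set (inflation \<sigma> \<tau>s)) = length (inflation \<sigma> \<tau>s)"
    using dist by (rule distinct_card)
  ultimately have "set (inflation \<sigma> \<tau>s) = {1..length (inflation \<sigma> \<tau>s)}"
    by (intro card_subset_eq) auto
  with dist show ?thesis by (simp add: is_perm_iff)
qed

end

theory Submission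
  imports Defs
begin

text \<open>
  Cut the positions of the inflation of \<open>\<sigma>\<close> by n copies of \<open>\<tau>\<close> (of size l) into n blocks of
  length l. A window of size k inside a single block sees a window of \<open>\<tau>\<close>, and at most nk windows
  meet two blocks, a negligible proportion of nl as l grows. An index set of size k meeting every
  block at most once sees the pattern of \<open>\<sigma>\<close> at its block indices; each k-set of block indices
  arises from l^k such sets, and the proportion of index sets meeting some block twice vanishes as n
  grows.
\<close>

section \<open>Relative order along index lists\<close>

text \<open>Only comparisons between entries matter, not the entries themselves. The index lists
  \<open>xs\<close> and \<open>ys\<close> may differ, so that positions of an inflation can be
  matched with positions of a block or with block indices.\<close>

lemma same_rel_order_map_cong:
  assumes "length xs = length ys"
    and "\<And>a b. a < length xs \<Longrightarrow> b < length xs \<Longrightarrow> f (xs ! a) < f (xs ! b) \<longleftrightarrow> g (ys ! a) < g (ys ! b)"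
  shows "same_rel_order (map f xs) \<pi> \<longleftrightarrow> same_rel_order (map g ys) \<pi>"
  using assms by (auto simp: same_rel_order_def)

text \<open>Filtering \<open>[0..<length xs]\<close> by membership in \<open>I\<close> lists
  \<open>I\<close> in increasing order. Writing the subsequence as a map over an index list brings
  it into the form of \<open>same_rel_order_map_cong\<close>.\<close>

lemma nths_conv_map_sorted_list_of_set:
  assumes "I \<subseteq> {..<length xs}"
  shows "nths xs I = map (\<lambda>i. xs ! i) (sorted_list_of_set I)"
proof -
  have "sorted_list_of_set (set (filter (\<lambda>i. i \<in> I) [0..<length xs])) =
      filter (\<lambda>i. i \<in> I) [0..<length xs]"
    by (rule sorted_list_of_set.idem_if_sorted_distinct) (simp_all add: sorted_wrt_filter)
  moreover have "set (filter (\<lambda>i. i \<in> I) [0..<length xs]) = I"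
    using assms by auto
  moreover have "zip xs [0..<length xs] = map (\<lambda>i. (xs ! i, i)) [0..<length xs]"
    by (rule nth_equalityI) auto
  then have "nths xs I = map (\<lambda>i. xs ! i) (filter (\<lambda>i. i \<in> I) [0..<length xs])"
    by (simp add: nths_def filter_map comp_def)
  ultimately show ?thesis by simp
qed

lemma occurrences_iff:
  "I \<in> occurrences \<pi> \<sigma> \<longleftrightarrow>
    I \<subseteq> {..<length \<sigma>} \<and> same_rel_order (map (\<lambda>i. \<sigma> ! i) (sorted_list_of_set I)) \<pi>"
  by (auto simp: occurrences_def nths_conv_map_sorted_list_of_set)

lemma card_occurrence:
  assumes "I \<in> occurrences \<pi> \<sigma>"
  shows "card I = length \<pi>"
  using assms by (auto simp: occurrences_iff same_rel_order_def)

lemma finite_occurrences: "finite (occurrences \<pi> \<sigma>)"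
  by (rule finite_subset[of _ "Pow {..<length \<sigma>}"]) (auto simp: occurrences_def)

section \<open>Inflation by copies of one permutation\<close>

lemma block_div: "r < l \<Longrightarrow> (i * l + r) div l = (i::nat)"
  by simp

text \<open>Induction on the number of blocks: \<open>p\<close> lies in the earlier blocks or has
  the form \<open>n * l + r\<close> with \<open>r < l\<close>, in the last one.\<close>

lemma nth_concat_map_upt:
  assumes "\<And>i. i < n \<Longrightarrow> length (f i) = l" and "p < n * l"
  shows "concat (map f [0..<n]) ! p = f (p div l) ! (p mod l)"
  using assms
proof (induction n)
  case (Suc n)
  have len: "length (concat (map f [0..<n])) = n * l"
  proof -
    have "length (concat (map f [0..<n])) = (\<Sum>i\<leftarrow>[0..<n]. length (f i))"
      by (simp add: length_concat comp_def)
    also have "\<dots> = (\<Sum>i\<leftarrow>[0..<n]. l)"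
      using Suc.prems(1) by (intro arg_cong[of _ _ sum_list] map_cong) auto
    finally show ?thesis by (simp add: sum_list_triv)
  qed
  show ?case
  proof (cases "p < n * l")
    case True
    with Suc show ?thesis by (simp add: nth_append len)
  next
    case False
    then obtain r where r: "p = n * l + r" "r < l"
      using Suc.prems(2) by (metis add.commute add_less_cancel_left le_add_diff_inverse
          linorder_not_less mult_Suc)
    then show ?thesis by (simp add: nth_append len)
  qed
qed simp

lemma length_inflation_replicate:
  "length (inflation \<sigma> (replicate (length \<sigma>) \<tau>)) = length \<sigma> * length \<tau>"
  by (simp add: length_inflation)

lemma nth_inflation_replicate:
  assumes "p < length \<sigma> * length \<tau>"
  shows "inflation \<sigma> (replicate (length \<sigma>) \<tau>) ! p =
    block_offset \<sigma> (replicate (length \<sigma>) \<tau>) (p div length \<tau>) + \<tau> ! (p mod length \<tau>)"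
proof -
  have "0 < length \<tau>" using assms by (cases \<tau>) auto
  moreover have "p div length \<tau> < length \<sigma>"
    using assms by (simp add: less_mult_imp_div_less)
  moreover have "inflation \<sigma> (replicate (length \<sigma>) \<tau>) ! p =
      inflation_block \<sigma> (replicate (length \<sigma>) \<tau>) (p div length \<tau>) ! (p mod length \<tau>)"
    unfolding inflation_def
    by (rule nth_concat_map_upt) (use assms in \<open>simp_all add: inflation_block_def\<close>)
  ultimately show ?thesis by (simp add: inflation_block_def)
qed

text \<open>If \<open>\<sigma>\<close> is smaller at the first block, the two offsets differ by at
  least \<open>length \<tau>\<close>. Entries of \<open>\<tau>\<close> lie between 1 and
  \<open>length \<tau>\<close>, so they cannot undo this gap, and the lower bound 1 makes the
  inequality strict. As \<open>\<sigma>\<close> has distinct entries, the same argument with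
  \<open>p\<close> and \<open>q\<close> exchanged gives the converse.\<close>

lemma inflation_replicate_less_iff:
  assumes "is_perm \<sigma>" "is_perm \<tau>"
    and p: "p < length \<sigma> * length \<tau>" and q: "q < length \<sigma> * length \<tau>"
    and ne: "p div length \<tau> \<noteq> q div length \<tau>"
  shows "inflation \<sigma> (replicate (length \<sigma>) \<tau>) ! p < inflation \<sigma> (replicate (length \<sigma>) \<tau>) ! q \<longleftrightarrow>
    \<sigma> ! (p div length \<tau>) < \<sigma> ! (q div length \<tau>)"
proof -
  let ?x = "\<lambda>p. inflation \<sigma> (replicate (length \<sigma>) \<tau>) ! p"
  have l: "0 < length \<tau>" using p by (cases \<tau>) auto
  have mono: "?x p < ?x q"
    if p: "p < length \<sigma> * length \<tau>" and q: "q < length \<sigma> * length \<tau>"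
      and less: "\<sigma> ! (p div length \<tau>) < \<sigma> ! (q div length \<tau>)" for p q
  proof -
    have bnds: "p div length \<tau> < length \<sigma>" "q div length \<tau> < length \<sigma>"
      using p q by (simp_all add: less_mult_imp_div_less)
    have "\<tau> ! (p mod length \<tau>) \<in> set \<tau>" "\<tau> ! (q mod length \<tau>) \<in> set \<tau>"
      using l by simp_all
    then have "\<tau> ! (p mod length \<tau>) \<le> length \<tau>" "0 < \<tau> ! (q mod length \<tau>)"
      using assms(2) by (auto simp: is_perm_iff)
    then show ?thesis
      using block_offset_mono[OF bnds(1) less, of "replicate (length \<sigma>) \<tau>"] bnds
      by (simp add: nth_inflation_replicate p q)
  qed
  have "p div length \<tau> < length \<sigma>" "q div length \<tau> < length \<sigma>"
    using p q by (simp_all add: less_mult_imp_div_less)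
  then have "\<sigma> ! (p div length \<tau>) \<noteq> \<sigma> ! (q div length \<tau>)"
    using assms(1) ne by (simp add: is_perm_iff nth_eq_iff_index_eq)
  then show ?thesis
    using mono[OF p q] mono[OF q p] by (meson linorder_neqE_nat order.asym)
qed

section \<open>Consecutive occurrences\<close>

text \<open>Consecutive occurrences encoded by their left endpoints, which are easier to count block
  by block than intervals.\<close>

definition window_starts :: "nat list \<Rightarrow> nat list \<Rightarrow> nat set" where
  "window_starts \<pi> \<sigma> = {i. i + length \<pi> \<le> length \<sigma> \<and>
     same_rel_order (map (\<lambda>j. \<sigma> ! j) [i..<i + length \<pi>]) \<pi>}"

lemma finite_window_starts: "finite (window_starts \<pi> \<sigma>)"
  by (rule finite_subset[of _ "{..length \<sigma>}"]) (auto simp: window_starts_def)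

text \<open>A nonempty interval determines its left endpoint. For an empty pattern all the intervals
  would collapse to the empty set.\<close>

lemma c_occ_eq_card_window_starts:
  assumes "\<pi> \<noteq> []"
  shows "c_occ \<pi> \<sigma> = card (window_starts \<pi> \<sigma>)"
proof -
  have sub: "{i..<i + length \<pi>} \<subseteq> {..<length \<sigma>} \<longleftrightarrow> i + length \<pi> \<le> length \<sigma>" for i
    using assms by (auto simp: atLeast0LessThan[symmetric])
  have "{I \<in> occurrences \<pi> \<sigma>. \<exists>i. I = {i..<i + length \<pi>}} =
      (\<lambda>i. {i..<i + length \<pi>}) ` window_starts \<pi> \<sigma>"
    by (auto simp: occurrences_iff window_starts_def sub simp del: ivl_subset)
  moreover have "inj_on (\<lambda>i. {i..<i + length \<pi>}) (window_starts \<pi> \<sigma>)"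
    using assms by (auto simp: inj_on_def atLeastLessThan_eq_iff)
  ultimately show ?thesis
    by (simp add: c_occ_def card_image)
qed

text \<open>All entries of a window inside one block carry the same offset, which cancels in every
  comparison.\<close>

lemma window_starts_inflation_iff:
  assumes "i < length \<sigma>" "r + length \<pi> \<le> length \<tau>" "\<pi> \<noteq> []"
  shows "i * length \<tau> + r \<in> window_starts \<pi> (inflation \<sigma> (replicate (length \<sigma>) \<tau>)) \<longleftrightarrow>
    r \<in> window_starts \<pi> \<tau>"
proof -
  let ?l = "length \<tau>" and ?k = "length \<pi>" and ?N = "length \<sigma> * length \<tau>"
  have "Suc i * ?l \<le> ?N" using assms(1) by (intro mult_right_mono) auto
  then have N: "i * ?l + ?l \<le> ?N" by simp
  have "inflation \<sigma> (replicate (length \<sigma>) \<tau>) ! (i * ?l + (r + a)) =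
      block_offset \<sigma> (replicate (length \<sigma>) \<tau>) i + \<tau> ! (r + a)" if "a < ?k" for a
  proof -
    have "r + a < ?l" using that assms(2) by simp
    then show ?thesis
      using nth_inflation_replicate[of "i * ?l + (r + a)" \<sigma> \<tau>] N by (simp add: block_div)
  qed
  then have "same_rel_order (map (\<lambda>j. inflation \<sigma> (replicate (length \<sigma>) \<tau>) ! j)
        [i * ?l + r..<i * ?l + r + ?k]) \<pi> \<longleftrightarrow>
      same_rel_order (map (\<lambda>j. \<tau> ! j) [r..<r + ?k]) \<pi>"
    by (intro same_rel_order_map_cong) (auto simp: add.assoc)
  then show ?thesis
    using N assms(2) by (simp add: window_starts_def length_inflation_replicate)
qed

text \<open>The windows inside single blocks contribute exactly the lower bound. All others start
  among the last \<open>length \<pi>\<close> positions of a block, which yields the additive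
  error.\<close>

lemma c_occ_inflation_bounds:
  assumes "\<pi> \<noteq> []"
  shows "length \<sigma> * c_occ \<pi> \<tau> \<le> c_occ \<pi> (inflation \<sigma> (replicate (length \<sigma>) \<tau>))"
    and "c_occ \<pi> (inflation \<sigma> (replicate (length \<sigma>) \<tau>)) \<le>
      length \<sigma> * c_occ \<pi> \<tau> + length \<sigma> * length \<pi>"
proof -
  let ?l = "length \<tau>" and ?n = "length \<sigma>" and ?k = "length \<pi>"
  let ?W = "window_starts \<pi> (inflation \<sigma> (replicate (length \<sigma>) \<tau>))"
  let ?pos = "\<lambda>(i, r). i * ?l + r"
  let ?A = "?pos ` ({..<?n} \<times> window_starts \<pi> \<tau>)"
  \<comment> \<open>A window leaving its block starts at some \<open>r > ?l - ?k\<close> within it;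
    admitting also \<open>r = ?l - ?k\<close> keeps the count at most \<open>?k\<close>. If
    \<open>?l < ?k\<close>, truncated subtraction makes the range the whole block.\<close>
  let ?B = "?pos ` ({..<?n} \<times> {?l - ?k..<?l})"
  have k: "0 < ?k" using assms by simp
  have inW: "r < ?l" "r + ?k \<le> ?l" if "r \<in> window_starts \<pi> \<tau>" for r
  proof -
    show "r + ?k \<le> ?l" using that by (simp add: window_starts_def)
    with k show "r < ?l" by linarith
  qed
  have "inj_on ?pos ({..<?n} \<times> window_starts \<pi> \<tau>)"
  proof (rule inj_onI, clarify)
    fix i r i' r'
    assume "r \<in> window_starts \<pi> \<tau>" "r' \<in> window_starts \<pi> \<tau>" and eq: "i * ?l + r = i' * ?l + r'"
    then have "r < ?l" "r' < ?l" by (auto dest: inW)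
    with arg_cong[OF eq, of "\<lambda>x. x div ?l"] arg_cong[OF eq, of "\<lambda>x. x mod ?l"]
    show "i = i' \<and> r = r'" by (simp add: block_div)
  qed
  then have cA: "card ?A = ?n * c_occ \<pi> \<tau>"
    by (simp add: card_image card_cartesian_product c_occ_eq_card_window_starts[OF assms])
  have "?A \<subseteq> ?W"
    using window_starts_inflation_iff[OF _ _ assms] inW by auto
  then have "card ?A \<le> card ?W" by (intro card_mono finite_window_starts)
  then show "?n * c_occ \<pi> \<tau> \<le> c_occ \<pi> (inflation \<sigma> (replicate (length \<sigma>) \<tau>))"
    by (simp add: cA c_occ_eq_card_window_starts[OF assms])
  have "?W \<subseteq> ?A \<union> ?B"
  proof
    fix p assume p: "p \<in> ?W"
    then have "p + ?k \<le> ?n * ?l"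
      by (simp add: window_starts_def length_inflation_replicate)
    with k have pN: "p < ?n * ?l" by linarith
    then have l: "0 < ?l" by (cases \<tau>) auto
    have n: "p div ?l < ?n" using pN by (simp add: less_mult_imp_div_less)
    have decomp: "p = ?pos (p div ?l, p mod ?l)" by simp
    show "p \<in> ?A \<union> ?B"
    proof (cases "p mod ?l + ?k \<le> ?l")
      case True
      have "p mod ?l \<in> window_starts \<pi> \<tau>"
        using window_starts_inflation_iff[OF n True assms] p by simp
      then show ?thesis using n by (intro UnI1 image_eqI[where f = ?pos, OF decomp]) auto
    next
      case False
      then show ?thesis using n l by (intro UnI2 image_eqI[where f = ?pos, OF decomp]) auto
    qed
  qed
  then have "card ?W \<le> card (?A \<union> ?B)"
    by (intro card_mono) (auto simp: finite_window_starts)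
  also have "\<dots> \<le> card ?A + card ?B" by (rule card_Un_le)
  also have "card ?B \<le> card ({..<?n} \<times> {?l - ?k..<?l})"
    by (rule card_image_le) simp
  also have "\<dots> \<le> ?n * ?k" by (simp add: card_cartesian_product) arith
  finally show "c_occ \<pi> (inflation \<sigma> (replicate (length \<sigma>) \<tau>)) \<le> ?n * c_occ \<pi> \<tau> + ?n * ?k"
    by (simp add: cA c_occ_eq_card_window_starts[OF assms])
qed

text \<open>Division of the counts by the size \<open>length \<sigma> * length \<tau>\<close>. The
  number of blocks cancels, so the error depends only on the block length.\<close>

lemma c_occ_prop_inflation_bounds:
  assumes "\<pi> \<noteq> []" "\<sigma> \<noteq> []"
  shows "c_occ_prop \<pi> \<tau> \<le> c_occ_prop \<pi> (inflation \<sigma> (replicate (length \<sigma>) \<tau>))"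
    and "c_occ_prop \<pi> (inflation \<sigma> (replicate (length \<sigma>) \<tau>)) \<le>
      c_occ_prop \<pi> \<tau> + real (length \<pi>) / real (length \<tau>)"
proof -
  let ?l = "real (length \<tau>)" and ?n = "real (length \<sigma>)" and ?k = "real (length \<pi>)"
  let ?c = "real (c_occ \<pi> (inflation \<sigma> (replicate (length \<sigma>) \<tau>)))"
  have n: "?n > 0" using assms by simp
  have lo: "?n * real (c_occ \<pi> \<tau>) \<le> ?c"
    using c_occ_inflation_bounds(1)[OF assms(1), of \<sigma> \<tau>] by (metis of_nat_le_iff of_nat_mult)
  have hi: "?c \<le> ?n * (real (c_occ \<pi> \<tau>) + ?k)"
    using c_occ_inflation_bounds(2)[OF assms(1), of \<sigma> \<tau>]
    by (metis distrib_left of_nat_add of_nat_le_iff of_nat_mult)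
  have quot: "c_occ_prop \<pi> (inflation \<sigma> (replicate (length \<sigma>) \<tau>)) = ?c / (?n * ?l)"
    by (simp add: c_occ_prop_def length_inflation_replicate)
  have "c_occ_prop \<pi> \<tau> = ?n * real (c_occ \<pi> \<tau>) / (?n * ?l)"
    using n by (simp add: c_occ_prop_def)
  also have "\<dots> \<le> ?c / (?n * ?l)" using lo by (intro divide_right_mono) auto
  finally show "c_occ_prop \<pi> \<tau> \<le> c_occ_prop \<pi> (inflation \<sigma> (replicate (length \<sigma>) \<tau>))"
    by (simp add: quot)
  have "?c / (?n * ?l) \<le> ?n * (real (c_occ \<pi> \<tau>) + ?k) / (?n * ?l)"
    using hi by (intro divide_right_mono) auto
  also have "\<dots> = c_occ_prop \<pi> \<tau> + ?k / ?l"
    using n by (simp add: c_occ_prop_def add_divide_distrib)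
  finally show "c_occ_prop \<pi> (inflation \<sigma> (replicate (length \<sigma>) \<tau>)) \<le> c_occ_prop \<pi> \<tau> + ?k / ?l"
    by (simp add: quot)
qed

section \<open>Classical occurrences\<close>

text \<open>\<open>p div l\<close> is the index of the block containing \<open>p\<close>.
  Injectivity says that \<open>I\<close> meets each block at most once; \<open>\<A>\<close>
  prescribes the admissible sets of blocks met.\<close>

definition transversals :: "nat \<Rightarrow> nat set set \<Rightarrow> nat set set" where
  "transversals l \<A> = {I. inj_on (\<lambda>p. p div l) I \<and> (\<lambda>p. p div l) ` I \<in> \<A>}"

lemma transversals_bound:
  fixes l n :: nat
  assumes "0 < l" "(\<lambda>p. p div l) ` I \<subseteq> {..<n}"
  shows "I \<subseteq> {..<n * l}"
proof
  fix p assume "p \<in> I"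
  then have "p div l < n" using assms(2) by auto
  then show "p \<in> {..<n * l}" using div_less_iff_less_mult[OF assms(1)] by simp
qed

text \<open>A transversal amounts to a set \<open>J\<close> of blocks together with a choice of one
  of the \<open>l\<close> places in each block of \<open>J\<close>. Extensional functions make this
  encoding one-to-one.\<close>

lemma card_transversals:
  assumes "finite \<A>" "0 < l" and "\<And>J. J \<in> \<A> \<Longrightarrow> finite J \<and> card J = k"
  shows "card (transversals l \<A>) = card \<A> * l ^ k"
proof -
  let ?S = "SIGMA J:\<A>. J \<rightarrow>\<^sub>E {..<l}"
  let ?h = "\<lambda>(J, f). (\<lambda>j. j * l + f j) ` J"
  have div: "(j * l + f j) div l = j" if "f \<in> J \<rightarrow>\<^sub>E {..<l}" "j \<in> J" for f J and j :: nat
    using PiE_mem[OF that] by simp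
  have img: "(\<lambda>p. p div l) ` ?h (J, f) = J" if "f \<in> J \<rightarrow>\<^sub>E {..<l}" for f J
    using div[OF that] by (force simp: image_image)
  have "bij_betw ?h ?S (transversals l \<A>)"
    unfolding bij_betw_def
  proof
    show "inj_on ?h ?S"
    proof (rule inj_onI, clarify)
      fix J f J' f'
      assume f: "f \<in> J \<rightarrow>\<^sub>E {..<l}" and f': "f' \<in> J' \<rightarrow>\<^sub>E {..<l}"
        and eq: "(\<lambda>j. j * l + f j) ` J = (\<lambda>j. j * l + f' j) ` J'"
      then have J: "J' = J" using img[OF f] img[OF f'] by simp
      have "f j = f' j" if j: "j \<in> J" for j
      proof -
        have "j * l + f j \<in> (\<lambda>j. j * l + f' j) ` J'" using eq j by blast
        then obtain j' where j': "j' \<in> J'" "j * l + f j = j' * l + f' j'" by auto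
        then have "j = j'" using div[OF f j] div[OF f' j'(1)] by metis
        with j' show ?thesis by simp
      qed
      then show "J = J' \<and> f = f'" using f f' J by (auto intro: PiE_ext)
    qed
    show "?h ` ?S = transversals l \<A>"
    proof
      show "?h ` ?S \<subseteq> transversals l \<A>"
      proof clarify
        fix J f assume J: "J \<in> \<A>" and f: "f \<in> J \<rightarrow>\<^sub>E {..<l}"
        have "inj_on (\<lambda>p. p div l) (?h (J, f))"
          using div[OF f] by (auto simp: inj_on_def)
        then show "(\<lambda>j. j * l + f j) ` J \<in> transversals l \<A>"
          using img[OF f] J by (simp add: transversals_def)
      qed
      show "transversals l \<A> \<subseteq> ?h ` ?S"
      proof
        fix I assume "I \<in> transversals l \<A>"
        then have inj: "inj_on (\<lambda>p. p div l) I" and I: "(\<lambda>p. p div l) ` I \<in> \<A>"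
          by (auto simp: transversals_def)
        let ?J = "(\<lambda>p. p div l) ` I"
        \<comment> \<open>The place, within block \<open>j\<close>, of the unique element of
          \<open>I\<close> in that block.\<close>
        let ?f = "restrict (\<lambda>j. the_inv_into I (\<lambda>p. p div l) j mod l) ?J"
        have inv: "the_inv_into I (\<lambda>p. p div l) (p div l) = p" if "p \<in> I" for p
          using the_inv_into_f_f[OF inj that] .
        have "?f \<in> ?J \<rightarrow>\<^sub>E {..<l}" using assms(2) by auto
        moreover have "?h (?J, ?f) = I"
          by (auto simp: image_image inv intro!: image_eqI)
        ultimately show "I \<in> ?h ` ?S" using I by (intro image_eqI[of _ _ "(?J, ?f)"]) auto
      qed
    qed
  qed
  then have "card (transversals l \<A>) = card ?S"
    by (simp add: bij_betw_same_card)
  also have "\<dots> = (\<Sum>J\<in>\<A>. card (J \<rightarrow>\<^sub>E {..<l}))"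
    using assms by (intro card_SigmaI) (auto intro!: finite_PiE)
  also have "\<dots> = (\<Sum>J\<in>\<A>. l ^ k)"
    using assms(3) by (intro sum.cong) (auto simp: card_PiE)
  finally show ?thesis by simp
qed

text \<open>Division by \<open>l\<close> is monotone, and injective on \<open>I\<close>, so it
  preserves sortedness and distinctness of the index list.\<close>

lemma sorted_list_of_set_image_div:
  fixes I :: "nat set"
  assumes "finite I" "inj_on (\<lambda>p. p div l) I"
  shows "sorted_list_of_set ((\<lambda>p. p div l) ` I) = map (\<lambda>p. p div l) (sorted_list_of_set I)"
proof -
  have "sorted (map (\<lambda>p. p div l) (sorted_list_of_set I))"
    by (auto simp: sorted_wrt_map intro!: sorted_wrt_mono_rel[OF _ sorted_sorted_list_of_set] div_le_mono)
  moreover have "distinct (map (\<lambda>p. p div l) (sorted_list_of_set I))"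
    using assms by (simp add: distinct_map)
  ultimately have "sorted_list_of_set (set (map (\<lambda>p. p div l) (sorted_list_of_set I))) =
      map (\<lambda>p. p div l) (sorted_list_of_set I)"
    by (rule sorted_list_of_set.idem_if_sorted_distinct)
  then show ?thesis using assms(1) by simp
qed

text \<open>Distinct elements of \<open>I\<close> lie in distinct blocks, so their entries compare
  as the entries of \<open>\<sigma>\<close> at the block indices do.\<close>

lemma occurrences_inflation_transversal:
  assumes "is_perm \<sigma>" "is_perm \<tau>" "\<tau> \<noteq> []"
    and inj: "inj_on (\<lambda>p. p div length \<tau>) I"
    and sub: "(\<lambda>p. p div length \<tau>) ` I \<subseteq> {..<length \<sigma>}"
  shows "I \<in> occurrences \<pi> (inflation \<sigma> (replicate (length \<sigma>) \<tau>)) \<longleftrightarrow>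
    (\<lambda>p. p div length \<tau>) ` I \<in> occurrences \<pi> \<sigma>"
proof -
  let ?l = "length \<tau>" and ?x = "\<lambda>p. inflation \<sigma> (replicate (length \<sigma>) \<tau>) ! p"
  let ?s = "sorted_list_of_set I"
  have I: "I \<subseteq> {..<length \<sigma> * ?l}" using transversals_bound[OF _ sub] assms(3) by simp
  then have fin: "finite I" using finite_subset by blast
  have "?x (?s ! a) < ?x (?s ! b) \<longleftrightarrow> \<sigma> ! (?s ! a div ?l) < \<sigma> ! (?s ! b div ?l)"
    if "a < length ?s" "b < length ?s" for a b
  \<comment> \<open>Equal positions make both comparisons false; unequal ones lie in different
    blocks by injectivity.\<close>
  proof (cases "?s ! a = ?s ! b")
    case False
    have "?s ! a \<in> I" "?s ! b \<in> I"
      using that fin nth_mem by (metis set_sorted_list_of_set)+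
    with I inj False show ?thesis
      by (intro inflation_replicate_less_iff assms(1,2)) (auto dest: inj_onD)
  qed simp
  then have "same_rel_order (map ?x ?s) \<pi> \<longleftrightarrow>
      same_rel_order (map (\<lambda>j. \<sigma> ! j) (map (\<lambda>p. p div ?l) ?s)) \<pi>"
    by (intro same_rel_order_map_cong) auto
  then show ?thesis
    using I sub by (simp add: occurrences_iff length_inflation_replicate
        sorted_list_of_set_image_div[OF fin inj])
qed

text \<open>Among the index sets of size \<open>length \<pi>\<close>, the transversal occurrences
  are counted exactly through those of \<open>\<sigma>\<close>. The upper bound treats every
  non-transversal set as an occurrence and is stated without subtraction, to remain in the
  naturals.\<close>

lemma occ_inflation_bounds:
  assumes "is_perm \<sigma>" "is_perm \<tau>" "\<tau> \<noteq> []"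
  defines "N \<equiv> length \<sigma> * length \<tau>"
  shows "occ \<pi> \<sigma> * length \<tau> ^ length \<pi> \<le> occ \<pi> (inflation \<sigma> (replicate (length \<sigma>) \<tau>))"
    and "occ \<pi> (inflation \<sigma> (replicate (length \<sigma>) \<tau>)) +
        (length \<sigma> choose length \<pi>) * length \<tau> ^ length \<pi> \<le>
      occ \<pi> \<sigma> * length \<tau> ^ length \<pi> + (N choose length \<pi>)"
    and "(length \<sigma> choose length \<pi>) * length \<tau> ^ length \<pi> \<le> N choose length \<pi>"
proof -
  let ?k = "length \<pi>" and ?n = "length \<sigma>" and ?l = "length \<tau>"
  let ?O = "occurrences \<pi> (inflation \<sigma> (replicate (length \<sigma>) \<tau>))"
  let ?K = "{J. J \<subseteq> {..<?n} \<and> card J = ?k}" and ?M = "{I. I \<subseteq> {..<N} \<and> card I = ?k}"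
  let ?T = "transversals ?l ?K" and ?U = "transversals ?l (occurrences \<pi> \<sigma>)"
  have l: "0 < ?l" using assms(3) by simp
  have finM: "finite ?M" by simp
  have cK: "card ?K = ?n choose ?k" and cM: "card ?M = N choose ?k"
    using n_subsets[of "{..<?n}"] n_subsets[of "{..<N}"] by simp_all
  have occK: "occurrences \<pi> \<sigma> \<subseteq> ?K"
    using card_occurrence by (auto simp: occurrences_def)
  have OM: "?O \<subseteq> ?M"
    by (auto simp: card_occurrence) (auto simp: occurrences_def N_def length_inflation_replicate)
  have cT: "card ?T = (?n choose ?k) * ?l ^ ?k"
    by (subst card_transversals[where k = ?k]) (auto simp: cK assms(3) intro: finite_subset)
  have cU: "card ?U = occ \<pi> \<sigma> * ?l ^ ?k"
    unfolding occ_def using occK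
    by (intro card_transversals) (auto simp: assms(3) finite_occurrences intro: finite_subset)
  have TM: "?T \<subseteq> ?M"
  proof
    fix I assume "I \<in> ?T"
    then have "inj_on (\<lambda>p. p div ?l) I" "(\<lambda>p. p div ?l) ` I \<subseteq> {..<?n}"
        "card ((\<lambda>p. p div ?l) ` I) = ?k"
      by (auto simp: transversals_def)
    with transversals_bound[OF l this(2)] show "I \<in> ?M"
      by (simp add: card_image N_def)
  qed
  \<comment> \<open>Occurrences of \<open>\<pi>\<close> in \<open>\<sigma>\<close> have the size
    required by \<open>?K\<close>, so every element of \<open>?U\<close> lies in
    \<open>?T\<close>.\<close>
  have OT: "?O \<inter> ?T = ?U"
  proof (rule set_eqI)
    fix I
    show "I \<in> ?O \<inter> ?T \<longleftrightarrow> I \<in> ?U"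
      using occurrences_inflation_transversal[OF assms(1-3), of I \<pi>] occK
      by (auto simp: transversals_def)
  qed
  have finO: "finite ?O" and finT: "finite ?T"
    using finite_subset[OF OM finM] finite_subset[OF TM finM] .
  show "(?n choose ?k) * ?l ^ ?k \<le> N choose ?k"
    using card_mono[OF finM TM] by (simp add: cT cM)
  have "card ?U \<le> card ?O" using OT by (intro card_mono finO) auto
  then show "occ \<pi> \<sigma> * ?l ^ ?k \<le> occ \<pi> (inflation \<sigma> (replicate (length \<sigma>) \<tau>))"
    by (simp add: cU occ_def)
  \<comment> \<open>Inclusion-exclusion, followed by the bound of the union by all index sets of the
    right size.\<close>
  have "card ?O + card ?T = card (?O \<union> ?T) + card ?U"
    using card_Un_Int[OF finO finT] by (simp add: OT)
  also have "card (?O \<union> ?T) \<le> card ?M" using OM TM by (intro card_mono finM) auto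
  finally show "occ \<pi> (inflation \<sigma> (replicate (length \<sigma>) \<tau>)) + (?n choose ?k) * ?l ^ ?k \<le>
      occ \<pi> \<sigma> * ?l ^ ?k + (N choose ?k)"
    by (simp add: cT cU cM occ_def[of _ "inflation _ _"])
qed

text \<open>Bounds from below the proportion of transversals among all index sets of size
  \<open>k\<close>. After multiplication by \<open>fact k\<close> both sides are products over
  \<open>i < k\<close>, compared factor by factor: dropping \<open>i\<close> from
  \<open>n * l - i\<close> leaves \<open>n * l * (1 - i / n) = (n - i) * l\<close>.\<close>

lemma binomial_mult_ge:
  assumes "k \<le> n" "0 < l"
  shows "real (n * l choose k) * (\<Prod>i<k. 1 - real i / real n) \<le> real (n choose k) * real l ^ k"
proof -
  have fact: "fact k * real (m choose k) = (\<Prod>i<k. real m - real i)" for m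
    by (simp add: binomial_gbinomial gbinomial_mult_fact atLeast0LessThan)
  have "fact k * (real (n * l choose k) * (\<Prod>i<k. 1 - real i / real n)) =
      (\<Prod>i<k. (real (n * l) - real i) * (1 - real i / real n))"
    using fact[of "n * l"] by (simp add: prod.distrib mult.assoc[symmetric])
  also have "\<dots> \<le> (\<Prod>i<k. (real n - real i) * real l)"
  proof (rule prod_mono, rule conjI)
    fix i assume i: "i \<in> {..<k}"
    then have n: "real i < real n" "real n > 0" using assms(1) by auto
    have "n * 1 \<le> n * l" using assms(2) by (intro mult_left_mono) auto
    then have nl: "real n \<le> real (n * l)" by (simp only: mult_1_right of_nat_le_iff)
    have nn: "0 \<le> 1 - real i / real n" using n by simp
    show "0 \<le> (real (n * l) - real i) * (1 - real i / real n)"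
      using n nl by (intro mult_nonneg_nonneg nn) linarith
    have "(real (n * l) - real i) * (1 - real i / real n) \<le> real (n * l) * (1 - real i / real n)"
      using nn by (intro mult_right_mono) auto
    also have "\<dots> = (real n - real i) * real l" using n by (simp add: field_simps)
    finally show "(real (n * l) - real i) * (1 - real i / real n) \<le> (real n - real i) * real l" .
  qed
  also have "\<dots> = fact k * (real (n choose k) * real l ^ k)"
    using fact[of n] by (simp add: prod.distrib mult.assoc[symmetric])
  finally show ?thesis by (simp add: mult_le_cancel_left_pos)
qed

lemma occ_prop_le_1: "occ_prop \<pi> \<sigma> \<le> 1"
proof -
  have "occurrences \<pi> \<sigma> \<subseteq> {I. I \<subseteq> {..<length \<sigma>} \<and> card I = length \<pi>}"
    using card_occurrence by (auto simp: occurrences_def)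
  then have "occ \<pi> \<sigma> \<le> card {I. I \<subseteq> {..<length \<sigma>} \<and> card I = length \<pi>}"
    unfolding occ_def by (intro card_mono) auto
  then have "occ \<pi> \<sigma> \<le> length \<sigma> choose length \<pi>"
    using n_subsets[of "{..<length \<sigma>}" "length \<pi>"] by simp
  then show ?thesis by (cases "length \<sigma> choose length \<pi> = 0") (simp_all add: occ_prop_def)
qed

text \<open>With \<open>\<rho>\<close> the proportion of transversals and \<open>x\<close> the
  density in \<open>\<sigma>\<close>, the density in the inflation lies between
  \<open>\<rho> * x\<close> and \<open>\<rho> * x + (1 - \<rho>)\<close>. Since \<open>x\<close> is
  in the unit interval, it differs from \<open>x\<close> by at most \<open>1 - \<rho>\<close>. The
  bound is uniform in \<open>\<tau>\<close>.\<close>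

lemma occ_prop_inflation_bounds:
  assumes "is_perm \<sigma>" "is_perm \<tau>" "\<tau> \<noteq> []" "length \<pi> \<le> length \<sigma>"
  defines "c \<equiv> \<Prod>i<length \<pi>. 1 - real i / real (length \<sigma>)"
  shows "\<bar>occ_prop \<pi> (inflation \<sigma> (replicate (length \<sigma>) \<tau>)) - occ_prop \<pi> \<sigma>\<bar> \<le> 1 - c"
proof -
  let ?k = "length \<pi>" and ?n = "length \<sigma>" and ?l = "length \<tau>"
  let ?o = "occ \<pi> (inflation \<sigma> (replicate (length \<sigma>) \<tau>))"
  let ?y = "occ_prop \<pi> (inflation \<sigma> (replicate (length \<sigma>) \<tau>))"
  define L where "L = real (?n * ?l choose ?k)"
  define b where "b = real (?n choose ?k) * real ?l ^ ?k"
  define x where "x = occ_prop \<pi> \<sigma>"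
  define \<rho> where "\<rho> = b / L"
  have l: "0 < ?l" using assms(3) by simp
  have "?n * 1 \<le> ?n * ?l" using l by (intro mult_left_mono) (simp_all add: Suc_le_eq)
  then have "?k \<le> ?n * ?l" using assms(4) by linarith
  then have L: "L > 0" by (simp add: L_def)
  have y: "?y = real ?o / L"
    by (simp add: occ_prop_def L_def length_inflation_replicate)
  \<comment> \<open>The binomial coefficient in the denominator of \<open>x\<close> is nonzero
    because the pattern is no longer than \<open>\<sigma>\<close>.\<close>
  have xb: "real (occ \<pi> \<sigma>) * real ?l ^ ?k = x * b"
    using assms(4) by (simp add: x_def b_def occ_prop_def)
  note bnds = occ_inflation_bounds[OF assms(1-3), of \<pi>, THEN of_nat_mono[where 'a = real],
      simplified of_nat_add of_nat_mult[of "_ choose _"] of_nat_mult[of "occ _ _"] of_nat_power,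
      folded L_def b_def, unfolded xb]
  have "\<rho> * x \<le> ?y" using bnds(1) L by (simp add: y \<rho>_def divide_right_mono mult.commute)
  moreover have "?y + \<rho> \<le> \<rho> * x + 1"
  proof -
    have "(real ?o + b) / L \<le> (x * b + L) / L" using bnds(2) L by (intro divide_right_mono) auto
    then show ?thesis using L by (simp add: y \<rho>_def add_divide_distrib mult.commute)
  qed
  moreover have \<rho>1: "\<rho> \<le> 1" using bnds(3) L by (simp add: \<rho>_def)
  moreover have "c \<le> \<rho>"
    using binomial_mult_ge[OF assms(4) l] L by (simp add: \<rho>_def b_def L_def c_def field_simps)
  \<comment> \<open>This product yields the upper estimate of the difference; the next one, which
    uses \<open>x \<le> 1\<close>, yields the lower estimate.\<close>
  moreover have "0 \<le> (1 - \<rho>) * x"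
    using \<rho>1 by (intro mult_nonneg_nonneg) (auto simp: x_def occ_prop_def)
  moreover have "0 \<le> (1 - \<rho>) * (1 - x)"
    using \<rho>1 occ_prop_le_1 by (intro mult_nonneg_nonneg) (auto simp: x_def)
  ultimately show ?thesis
    unfolding x_def[symmetric] by (simp add: algebra_simps abs_le_iff)
qed

section \<open>Passage to the limit along the two sequences\<close>

theorem theorem4p1:
  fixes k :: nat
    and v1 v2 :: "nat list \<Rightarrow> real"
    and \<sigma>1 \<sigma>2 \<sigma>3 :: "nat \<Rightarrow> nat list"
  assumes "k > 0"
    and "v1 \<in> consecutive_region k"
    and "v2 \<in> classical_region k"
    and "\<And>m. is_perm (\<sigma>1 m)"
    and "\<And>m. is_perm (\<sigma>2 m)"
    and "filterlim (\<lambda>m. length (\<sigma>1 m)) at_top sequentially"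
    and "\<And>\<pi>. \<pi> \<in> perms k \<Longrightarrow> (\<lambda>m. c_occ_prop \<pi> (\<sigma>1 m)) \<longlonglongrightarrow> v1 \<pi>"
    and "filterlim (\<lambda>m. length (\<sigma>2 m)) at_top sequentially"
    and "\<And>\<pi>. \<pi> \<in> perms k \<Longrightarrow> (\<lambda>m. occ_prop \<pi> (\<sigma>2 m)) \<longlonglongrightarrow> v2 \<pi>"
    and "\<And>m. \<sigma>3 m = inflation (\<sigma>2 m) (replicate (length (\<sigma>2 m)) (\<sigma>1 m))"
  shows "filterlim (\<lambda>m. length (\<sigma>3 m)) at_top sequentially \<and>
    (\<forall>\<pi>\<in>perms k. (\<lambda>m. c_occ_prop \<pi> (\<sigma>3 m)) \<longlonglongrightarrow> v1 \<pi>) \<and>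
    (\<forall>\<pi>\<in>perms k. (\<lambda>m. occ_prop \<pi> (\<sigma>3 m)) \<longlonglongrightarrow> v2 \<pi>)"
proof (intro conjI ballI)
  note perm1 = assms(4) and perm2 = assms(5) and lim1 = assms(6) and lim2 = assms(8)
  have \<sigma>3: "\<sigma>3 m = inflation (\<sigma>2 m) (replicate (length (\<sigma>2 m)) (\<sigma>1 m))" for m
    by (rule assms(10))
  \<comment> \<open>Nonempty blocks ensure that the inflation is at least as long as
    \<open>\<sigma>2 m\<close>, and the classical estimate requires them.\<close>
  have ev1: "\<forall>\<^sub>F m in sequentially. \<sigma>1 m \<noteq> []"
    using eventually_compose_filterlim[OF eventually_gt_at_top[of 0] lim1] by eventually_elim auto
  have ev2: "\<forall>\<^sub>F m in sequentially. k \<le> length (\<sigma>2 m)"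
    using lim2 by (auto simp: filterlim_at_top)
  have real1: "filterlim (\<lambda>m. real (length (\<sigma>1 m))) at_top sequentially"
    and real2: "filterlim (\<lambda>m. real (length (\<sigma>2 m))) at_top sequentially"
    using filterlim_compose[OF filterlim_real_sequentially lim1]
      filterlim_compose[OF filterlim_real_sequentially lim2] by auto
  show "filterlim (\<lambda>m. length (\<sigma>3 m)) at_top sequentially"
  proof (rule filterlim_at_top_mono[OF lim2])
    show "\<forall>\<^sub>F m in sequentially. length (\<sigma>2 m) \<le> length (\<sigma>3 m)"
      using ev1 by eventually_elim (simp add: \<sigma>3 length_inflation_replicate Suc_le_eq)
  qed
  fix \<pi> assume \<pi>: "\<pi> \<in> perms k"
  then have len: "length \<pi> = k" by (simp only: perms_iff)
  then have ne: "\<pi> \<noteq> []" using assms(1) by auto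
  show "(\<lambda>m. c_occ_prop \<pi> (\<sigma>3 m)) \<longlonglongrightarrow> v1 \<pi>"
  proof (rule tendsto_sandwich)
    have ev2': "\<forall>\<^sub>F m in sequentially. \<sigma>2 m \<noteq> []"
      using ev2 by eventually_elim (use assms(1) in auto)
    show "\<forall>\<^sub>F m in sequentially. c_occ_prop \<pi> (\<sigma>1 m) \<le> c_occ_prop \<pi> (\<sigma>3 m)"
      using ev2' by eventually_elim (simp add: \<sigma>3 c_occ_prop_inflation_bounds ne)
    show "\<forall>\<^sub>F m in sequentially. c_occ_prop \<pi> (\<sigma>3 m) \<le>
        c_occ_prop \<pi> (\<sigma>1 m) + real k / real (length (\<sigma>1 m))"
      using ev2' by eventually_elim
        (simp only: \<sigma>3 c_occ_prop_inflation_bounds(2)[OF ne, unfolded len] not_False_eq_True)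
    show "(\<lambda>m. c_occ_prop \<pi> (\<sigma>1 m)) \<longlonglongrightarrow> v1 \<pi>" using assms(7) \<pi> .
    show "(\<lambda>m. c_occ_prop \<pi> (\<sigma>1 m) + real k / real (length (\<sigma>1 m))) \<longlonglongrightarrow> v1 \<pi>"
      using tendsto_add[OF assms(7)[OF \<pi>] tendsto_divide_0[OF tendsto_const
            filterlim_at_top_imp_at_infinity[OF real1]]] by simp
  qed
  show "(\<lambda>m. occ_prop \<pi> (\<sigma>3 m)) \<longlonglongrightarrow> v2 \<pi>"
  proof (rule Lim_transform)
    show "(\<lambda>m. occ_prop \<pi> (\<sigma>2 m)) \<longlonglongrightarrow> v2 \<pi>" using assms(9) \<pi> .
    \<comment> \<open>The number \<open>k\<close> of factors is fixed and each factor tends to 1, so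
      the error bound vanishes in the limit.\<close>
    have "(\<lambda>m. 1 - (\<Prod>i<k. 1 - real i / real (length (\<sigma>2 m)))) \<longlonglongrightarrow> 1 - (\<Prod>i<k. 1 - 0)"
      by (intro tendsto_diff tendsto_prod tendsto_const tendsto_divide_0[OF tendsto_const]
          filterlim_at_top_imp_at_infinity[OF real2])
    then have "(\<lambda>m. 1 - (\<Prod>i<k. 1 - real i / real (length (\<sigma>2 m)))) \<longlonglongrightarrow> 0" by simp
    moreover have "\<forall>\<^sub>F m in sequentially. \<bar>occ_prop \<pi> (\<sigma>3 m) - occ_prop \<pi> (\<sigma>2 m)\<bar> \<le>
        1 - (\<Prod>i<k. 1 - real i / real (length (\<sigma>2 m)))"
      using ev1 ev2
      by eventually_elim
        (simp only: \<sigma>3 len occ_prop_inflation_bounds[OF perm2 perm1, where \<pi> = \<pi>,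
            unfolded len] not_False_eq_True)
    ultimately have "(\<lambda>m. \<bar>occ_prop \<pi> (\<sigma>3 m) - occ_prop \<pi> (\<sigma>2 m)\<bar>) \<longlonglongrightarrow> 0"
      using tendsto_sandwich[OF always_eventually[OF allI[OF abs_ge_zero]] _ tendsto_const] by fast
    then show "(\<lambda>m. occ_prop \<pi> (\<sigma>3 m) - occ_prop \<pi> (\<sigma>2 m)) \<longlonglongrightarrow> 0"
      by (rule tendsto_rabs_zero_cancel)
  qed
qed

end
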